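(* Let $G_1$ and $G_2$ be groups and suppose that $G_1$ is a torsion group. Then the groups $G_1$ and $G_2$ are isomorphic if and only if their monoids of product-one sequences $\mathcal{B}(G_1)$ and $\mathcal{B}(G_2)$ are isomorphic (as monoids).
   Context: Groups are written multiplicatively and may be finite or infinite, abelian or non-abelian; $1_G$ denotes the identity element of a group $G$. A torsion group is a group in which every element has finite order. For a group $G$, let $\mathcal{F}(G)$ denote the free abelian monoid with basis the underlying set of $G$ (equivalently, finite multisets of elements of $G$ under multiset sum). Its elements are called sequences over $G$: finite unordered sequences $S = g_1 \boldsymbol{\cdot} \ldots \boldsymbol{\cdot} g_\ell$ ($\ell \ge 0$, $g_1, \ldots, g_\ell \in G$) with repetition allowed, where $\boldsymbol{\cdot}$ denotes the operation (concatenation) of $\mathcal{F}(G)$, which is distinct from the group operation of $G$. The set of products of $S$ is $$\pi(S) = \{ g_{\tau(1)} g_{\tau(2)} \cdots g_{\tau(\ell)} \in G : \tau \text{ is a permutation of } \{1, \ldots, \ell\} \} \subset G,$$ with the empty sequence (the identity of $\mathcal{F}(G)$) having set of products $\{1_G\}$. The sequence $S$ is called a product-one sequence if $1_G \in \pi(S)$, i.e. if its terms can be ordered so that their product in $G$ equals $1_G$. The monoid of product-one sequences over $G$ is the submonoid $$\mathcal{B}(G) = \{ S \in \mathcal{F}(G) : 1_G \in \pi(S) \} \subset \mathcal{F}(G).$$ *)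

theory Defs
  imports "HOL-Algebra.Group" "HOL-Combinatorics.Multiset_Permutations"
begin

definition torsion_group :: "('a, 'b) monoid_scheme \<Rightarrow> bool" where
  "torsion_group G \<longleftrightarrow>
     group G \<and> (\<forall>x\<in>carrier G. \<exists>n::nat. n > 0 \<and> x [^]\<^bsub>G\<^esub> n = \<one>\<^bsub>G\<^esub>)"

text \<open>The monoid $\mathcal{F}(G)$: the free abelian monoid on the underlying set of $G$, realised
  as the finite multisets of elements of the carrier under multiset sum.\<close>

definition sequence_monoid :: "('a, 'b) monoid_scheme \<Rightarrow> 'a multiset monoid" where
  "sequence_monoid G = \<lparr>carrier = {S. set_mset S \<subseteq> carrier G}, monoid.mult = (+), one = {#}\<rparr>"

definition ordered_product :: "('a, 'b) monoid_scheme \<Rightarrow> 'a list \<Rightarrow> 'a" where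
  "ordered_product G gs = foldr (\<otimes>\<^bsub>G\<^esub>) gs \<one>\<^bsub>G\<^esub>"

text \<open>The set $\pi(S)$: the orderings of the terms of $S$ are the lists whose underlying
  multiset is $S$.\<close>

definition products :: "('a, 'b) monoid_scheme \<Rightarrow> 'a multiset \<Rightarrow> 'a set" where
  "products G S = ordered_product G ` permutations_of_multiset S"

text \<open>The submonoid $\mathcal{B}(G)$ of $\mathcal{F}(G)$.\<close>

definition product_one_monoid :: "('a, 'b) monoid_scheme \<Rightarrow> 'a multiset monoid" where
  "product_one_monoid G =
     (sequence_monoid G)\<lparr>carrier := {S \<in> carrier (sequence_monoid G). \<one>\<^bsub>G\<^esub> \<in> products G S}\<rparr>"

lemma products_empty: "products G {#} = {\<one>\<^bsub>G\<^esub>}"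
  by (simp add: products_def ordered_product_def)

lemma (in monoid) ordered_product_closed:
  "set xs \<subseteq> carrier G \<Longrightarrow> ordered_product G xs \<in> carrier G"
  by (induction xs) (auto simp: ordered_product_def)

lemma (in monoid) ordered_product_append:
  "set xs \<subseteq> carrier G \<Longrightarrow> set ys \<subseteq> carrier G \<Longrightarrow>
     ordered_product G (xs @ ys) = ordered_product G xs \<otimes> ordered_product G ys"
proof (induction xs)
  case Nil
  then show ?case
    using ordered_product_closed[of ys] by (simp add: ordered_product_def)
next
  case (Cons x xs)
  then show ?case
    using ordered_product_closed[of xs] ordered_product_closed[of ys]
    by (simp add: ordered_product_def m_assoc)
qed

lemma comm_monoid_sequence_monoid: "comm_monoid (sequence_monoid G)"
  by unfold_locales (auto simp: sequence_monoid_def)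

lemma (in monoid) submonoid_product_one:
  "submonoid (carrier (product_one_monoid G)) (sequence_monoid G)"
proof
  show "carrier (product_one_monoid G) \<subseteq> carrier (sequence_monoid G)"
    by (auto simp: product_one_monoid_def)
  show "\<one>\<^bsub>sequence_monoid G\<^esub> \<in> carrier (product_one_monoid G)"
    by (simp add: product_one_monoid_def sequence_monoid_def products_empty)
next
  fix S T
  assume "S \<in> carrier (product_one_monoid G)" "T \<in> carrier (product_one_monoid G)"
  then obtain xs ys where
    S: "set_mset S \<subseteq> carrier G" "mset xs = S" "ordered_product G xs = \<one>" and
    T: "set_mset T \<subseteq> carrier G" "mset ys = T" "ordered_product G ys = \<one>"
    by (auto simp: product_one_monoid_def sequence_monoid_def products_def
        permutations_of_multiset_def)
  have "ordered_product G (xs @ ys) = \<one>"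
    using S T ordered_product_append[of xs ys] by auto
  then have "\<one> \<in> products G (S + T)"
    using S T unfolding products_def permutations_of_multiset_def
    by (intro image_eqI[of _ _ "xs @ ys"]) auto
  then show "S \<otimes>\<^bsub>sequence_monoid G\<^esub> T \<in> carrier (product_one_monoid G)"
    using S(1) T(1) by (auto simp: product_one_monoid_def sequence_monoid_def)
qed

text \<open>The library's isomorphism relation only asks for a bijection of the carriers compatible with
  the multiplication.  On monoids this is the usual notion of isomorphism, since such a bijection
  automatically preserves the unit.\<close>

lemma iso_monoid_one:
  assumes "monoid M" "monoid N" "f \<in> iso M N"
  shows "f \<one>\<^bsub>M\<^esub> = \<one>\<^bsub>N\<^esub>"
proof -
  interpret M: monoid M by fact
  interpret N: monoid N by fact
  have hom: "\<And>x y. x \<in> carrier M \<Longrightarrow> y \<in> carrier M \<Longrightarrow> f (x \<otimes>\<^bsub>M\<^esub> y) = f x \<otimes>\<^bsub>N\<^esub> f y"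
    and bij: "bij_betw f (carrier M) (carrier N)"
    using assms(3) by (auto simp: iso_def hom_def)
  obtain e where e: "e \<in> carrier M" "f e = \<one>\<^bsub>N\<^esub>"
    using bij N.one_closed by (metis bij_betw_imp_surj_on imageE)
  have "f \<one>\<^bsub>M\<^esub> \<in> carrier N"
    using bij M.one_closed by (meson bij_betwE)
  then show ?thesis
    using hom[of "\<one>\<^bsub>M\<^esub>" e] e by simp
qed

end

theory Submission
  imports Defs "HOL-Algebra.Multiplicative_Group"
begin

text \<open>
  An isomorphism of groups clearly induces one of the monoids of product-one sequences.  For the
  converse let $\Phi$ be an isomorphism between the monoids over $G$ and $H$, with $G$ torsion.

  For $g$ of finite order let $U_g$ be the sequence that repeats $g$ exactly $\mathrm{ord}(g)$
  times.  Over a torsion group the $U_g$ are the extremal rays of the monoid: some positive multiple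
  of any sequence is a sum of such $U_g$, and this sum is determined by the multiplicities.  This
  forces $H$ to be torsion (\<open>torsion_codomain\<close>), and then $\Phi$ has to permute the extremal
  rays: $\Phi(U_g) = U_{f(g)}$ for a bijection $f$ of the carriers (\<open>ex_order_seq_bij\<close>).
  Consequently the multiplicity of $f(g)$ in $\Phi(S)$ is that of $g$ in $S$ scaled by
  $\mathrm{ord}(f(g)) / \mathrm{ord}(g)$.  If the groups have at least three elements, every element
  occurs exactly once in some product-one sequence, so that this factor and its reciprocal are
  integers; hence it is $1$ and $\Phi$ just applies $f$ to every term (\<open>eq_image_mset\<close>).

  Now the image of the product-one sequence with terms $x$, $y$, $(xy)^{-1}$ can be ordered to have
  product one, and $f$ commutes with inversion for a similar reason.  The possible orderings say
  precisely that $f(xy)$ is $f(x)f(y)$ or $f(y)f(x)$: the map $f$ is a half-homomorphism.  By a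
  theorem of Scott (\<open>hom_or_antihom\<close>), the choice between the two can be made the same for all pairs, so
  $f$ is an isomorphism or an anti-isomorphism.  In the latter case composing with inversion gives an
  isomorphism.  Groups with at most two elements are compared directly
  (\<open>small_groups_iso\<close>).
\<close>

section \<open>Half-homomorphisms of groups\<close>

locale injective_half_homomorphism = G: group G + H: group H
  for G (structure) and H (structure) +
  fixes f
  assumes closed [simp, intro]: "x \<in> carrier G \<Longrightarrow> f x \<in> carrier H"
    and inj: "inj_on f (carrier G)"
    and half: "\<lbrakk>x \<in> carrier G; y \<in> carrier G\<rbrakk> \<Longrightarrow>
      f (x \<otimes> y) = f x \<otimes>\<^bsub>H\<^esub> f y \<or> f (x \<otimes> y) = f y \<otimes>\<^bsub>H\<^esub> f x"
begin

text \<open>If $xy = yx$ while $a = f(x)$ and $b = f(y)$ do not commute, the two ways of splitting $xy^2$ leave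
  only $f(xy^2) = ab^2$.  Then $(xy)^2 = x \cdot xy^2$ has image $abab$, but also $a^2b^2$ or $ab^2a$,
  and either equality makes $a$ and $b$ commute.\<close>

lemma images_commute:
  assumes xy: "x \<in> carrier G" "y \<in> carrier G" and comm: "x \<otimes> y = y \<otimes> x"
    and eq: "f (x \<otimes> y) = f x \<otimes>\<^bsub>H\<^esub> f y"
  shows "f x \<otimes>\<^bsub>H\<^esub> f y = f y \<otimes>\<^bsub>H\<^esub> f x"
proof (rule ccontr)
  define a b where "a = f x" and "b = f y"
  assume "f x \<otimes>\<^bsub>H\<^esub> f y \<noteq> f y \<otimes>\<^bsub>H\<^esub> f x"
  then have ne: "a \<otimes>\<^bsub>H\<^esub> b \<noteq> b \<otimes>\<^bsub>H\<^esub> a"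
    by (simp add: a_def b_def)
  have ab [simp]: "a \<in> carrier H" "b \<in> carrier H"
    using xy by (auto simp: a_def b_def)
  have fxy: "f (x \<otimes> y) = a \<otimes>\<^bsub>H\<^esub> b"
    using eq by (simp add: a_def b_def)
  have "f (y \<otimes> y) = b \<otimes>\<^bsub>H\<^esub> b"
    using half[of y y] xy by (auto simp: b_def)
  then have 1: "f (x \<otimes> (y \<otimes> y)) = a \<otimes>\<^bsub>H\<^esub> (b \<otimes>\<^bsub>H\<^esub> b) \<or> f (x \<otimes> (y \<otimes> y)) = b \<otimes>\<^bsub>H\<^esub> b \<otimes>\<^bsub>H\<^esub> a"
    using half[of x "y \<otimes> y"] xy by (auto simp: a_def)
  have 2: "f (x \<otimes> (y \<otimes> y)) = a \<otimes>\<^bsub>H\<^esub> b \<otimes>\<^bsub>H\<^esub> b \<or> f (x \<otimes> (y \<otimes> y)) = b \<otimes>\<^bsub>H\<^esub> (a \<otimes>\<^bsub>H\<^esub> b)"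
    using half[of "x \<otimes> y" y] xy fxy by (auto simp: b_def G.m_assoc)
  have n1: "b \<otimes>\<^bsub>H\<^esub> (a \<otimes>\<^bsub>H\<^esub> b) \<noteq> a \<otimes>\<^bsub>H\<^esub> (b \<otimes>\<^bsub>H\<^esub> b)"
    using ne by (metis ab H.m_assoc H.right_cancel H.m_closed)
  have n2: "b \<otimes>\<^bsub>H\<^esub> (a \<otimes>\<^bsub>H\<^esub> b) \<noteq> b \<otimes>\<^bsub>H\<^esub> b \<otimes>\<^bsub>H\<^esub> a"
    using ne by (simp add: H.m_assoc)
  have fxyy: "f (x \<otimes> (y \<otimes> y)) = a \<otimes>\<^bsub>H\<^esub> (b \<otimes>\<^bsub>H\<^esub> b)"
    using 1 2 n1 n2 by (auto simp: H.m_assoc)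
  have "(x \<otimes> y) \<otimes> (x \<otimes> y) = x \<otimes> (x \<otimes> (y \<otimes> y))"
    using xy by (metis comm G.m_assoc G.m_closed)
  moreover have "f ((x \<otimes> y) \<otimes> (x \<otimes> y)) = a \<otimes>\<^bsub>H\<^esub> b \<otimes>\<^bsub>H\<^esub> (a \<otimes>\<^bsub>H\<^esub> b)"
    using half[of "x \<otimes> y" "x \<otimes> y"] xy fxy by auto
  ultimately have "a \<otimes>\<^bsub>H\<^esub> b \<otimes>\<^bsub>H\<^esub> (a \<otimes>\<^bsub>H\<^esub> b) = a \<otimes>\<^bsub>H\<^esub> (a \<otimes>\<^bsub>H\<^esub> (b \<otimes>\<^bsub>H\<^esub> b))
      \<or> a \<otimes>\<^bsub>H\<^esub> b \<otimes>\<^bsub>H\<^esub> (a \<otimes>\<^bsub>H\<^esub> b) = a \<otimes>\<^bsub>H\<^esub> (b \<otimes>\<^bsub>H\<^esub> b) \<otimes>\<^bsub>H\<^esub> a"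
    using half[of x "x \<otimes> (y \<otimes> y)"] xy fxyy by (auto simp: a_def)
  with n1 ne show False
    by (auto simp: H.m_assoc)
qed

lemma commute_iff:
  assumes xy: "x \<in> carrier G" "y \<in> carrier G"
  shows "f x \<otimes>\<^bsub>H\<^esub> f y = f y \<otimes>\<^bsub>H\<^esub> f x \<longleftrightarrow> x \<otimes> y = y \<otimes> x"
proof
  assume "f x \<otimes>\<^bsub>H\<^esub> f y = f y \<otimes>\<^bsub>H\<^esub> f x"
  then have "f (x \<otimes> y) = f (y \<otimes> x)"
    using half[of x y] half[of y x] xy by auto
  then show "x \<otimes> y = y \<otimes> x"
    using inj xy by (auto dest: inj_onD)
next
  assume "x \<otimes> y = y \<otimes> x"
  then show "f x \<otimes>\<^bsub>H\<^esub> f y = f y \<otimes>\<^bsub>H\<^esub> f x"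
    using images_commute[of x y] images_commute[of y x] half[of x y] xy by metis
qed

text \<open>By injectivity, $f(xy)$ and $f(yx)$ cannot be the same one of the two candidate products unless
  $x$ and $y$ commute.  So the orientation of a pair does not depend on the order of its members.\<close>

lemma swap_hom:
  assumes xy: "x \<in> carrier G" "y \<in> carrier G" and eq: "f (x \<otimes> y) = f x \<otimes>\<^bsub>H\<^esub> f y"
  shows "f (y \<otimes> x) = f y \<otimes>\<^bsub>H\<^esub> f x"
proof (cases "x \<otimes> y = y \<otimes> x")
  case True
  then show ?thesis
    using commute_iff[OF xy] eq by simp
next
  case False
  then have "f (x \<otimes> y) \<noteq> f (y \<otimes> x)"
    using inj xy by (auto dest: inj_onD)
  then show ?thesis
    using half[of y x] xy eq by metis
qed

lemma swap_antihom:
  assumes xy: "x \<in> carrier G" "y \<in> carrier G" and eq: "f (x \<otimes> y) = f y \<otimes>\<^bsub>H\<^esub> f x"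
  shows "f (y \<otimes> x) = f x \<otimes>\<^bsub>H\<^esub> f y"
proof (cases "x \<otimes> y = y \<otimes> x")
  case True
  then show ?thesis
    using commute_iff[OF xy] eq by simp
next
  case False
  then have "f (x \<otimes> y) \<noteq> f (y \<otimes> x)"
    using inj xy by (auto dest: inj_onD)
  then show ?thesis
    using half[of y x] xy eq by metis
qed

text \<open>An element $x$ cannot be in a positively oriented non-commuting pair with $y$ and in a negatively
  oriented one with $z$.  With $a$, $b$, $c$ for the images of $x$, $y$, $z$, evaluating $f$ at
  $xz = (xy)(y^{-1}z)$ yields $cab = abc$ or $bca = cab$, and evaluating it at $zxy$ yields
  $cab = bac$ or $bc = cb$.  Each of the four combinations makes $a$ commute with $b$ or $c$.\<close>

lemma same_orientation:
  assumes xyz: "x \<in> carrier G" "y \<in> carrier G" "z \<in> carrier G"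
    and y: "x \<otimes> y \<noteq> y \<otimes> x" "f (x \<otimes> y) = f x \<otimes>\<^bsub>H\<^esub> f y"
    and z: "x \<otimes> z \<noteq> z \<otimes> x" "f (x \<otimes> z) = f z \<otimes>\<^bsub>H\<^esub> f x"
  shows False
proof -
  \<comment> \<open>Splitting off $y$ on the left relates both $z = yt$ and $xz = (xy)t$ to the image of $t$.\<close>
  define t where "t = inv y \<otimes> z"
  define a b c w where "a = f x" and "b = f y" and "c = f z" and "w = f t"
  have t: "t \<in> carrier G" "y \<otimes> t = z"
    using xyz by (auto simp: t_def simp flip: G.m_assoc)
  have abc [simp]: "a \<in> carrier H" "b \<in> carrier H" "c \<in> carrier H" "w \<in> carrier H"
    using xyz t by (auto simp: a_def b_def c_def w_def)
  have ne: "a \<otimes>\<^bsub>H\<^esub> b \<noteq> b \<otimes>\<^bsub>H\<^esub> a" "a \<otimes>\<^bsub>H\<^esub> c \<noteq> c \<otimes>\<^bsub>H\<^esub> a"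
    using y z xyz commute_iff by (auto simp: a_def b_def c_def)
  have c: "c = b \<otimes>\<^bsub>H\<^esub> w \<or> c = w \<otimes>\<^bsub>H\<^esub> b"
    using half[of y t] t xyz by (auto simp: b_def c_def w_def)
  have ca: "c \<otimes>\<^bsub>H\<^esub> a = a \<otimes>\<^bsub>H\<^esub> b \<otimes>\<^bsub>H\<^esub> w \<or> c \<otimes>\<^bsub>H\<^esub> a = w \<otimes>\<^bsub>H\<^esub> (a \<otimes>\<^bsub>H\<^esub> b)"
    using half[of "x \<otimes> y" t] t xyz y z by (auto simp: a_def b_def c_def w_def G.m_assoc)
  have 1: "c \<otimes>\<^bsub>H\<^esub> (a \<otimes>\<^bsub>H\<^esub> b) = a \<otimes>\<^bsub>H\<^esub> (b \<otimes>\<^bsub>H\<^esub> c)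
      \<or> b \<otimes>\<^bsub>H\<^esub> (c \<otimes>\<^bsub>H\<^esub> a) = c \<otimes>\<^bsub>H\<^esub> (a \<otimes>\<^bsub>H\<^esub> b)"
    using c
  proof
    assume c: "c = b \<otimes>\<^bsub>H\<^esub> w"
    then have "c \<otimes>\<^bsub>H\<^esub> a \<noteq> a \<otimes>\<^bsub>H\<^esub> b \<otimes>\<^bsub>H\<^esub> w"
      using ne by (simp add: H.m_assoc)
    with ca have "c \<otimes>\<^bsub>H\<^esub> a = w \<otimes>\<^bsub>H\<^esub> (a \<otimes>\<^bsub>H\<^esub> b)"
      by blast
    then show ?thesis
      using c by (simp add: H.m_assoc)
  next
    assume c: "c = w \<otimes>\<^bsub>H\<^esub> b"
    then have "c \<otimes>\<^bsub>H\<^esub> a \<noteq> w \<otimes>\<^bsub>H\<^esub> (a \<otimes>\<^bsub>H\<^esub> b)"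
      using ne by (simp add: H.m_assoc)
    with ca have "c \<otimes>\<^bsub>H\<^esub> a = a \<otimes>\<^bsub>H\<^esub> b \<otimes>\<^bsub>H\<^esub> w"
      by blast
    then have "c \<otimes>\<^bsub>H\<^esub> a \<otimes>\<^bsub>H\<^esub> b = a \<otimes>\<^bsub>H\<^esub> b \<otimes>\<^bsub>H\<^esub> w \<otimes>\<^bsub>H\<^esub> b"
      by simp
    then show ?thesis
      using c by (simp add: H.m_assoc)
  qed
  have zx: "f (z \<otimes> x) = a \<otimes>\<^bsub>H\<^esub> c"
    using swap_antihom[OF _ _ z(2)] xyz by (simp add: a_def c_def)
  have "f (z \<otimes> x \<otimes> y) = c \<otimes>\<^bsub>H\<^esub> (a \<otimes>\<^bsub>H\<^esub> b) \<or> f (z \<otimes> x \<otimes> y) = a \<otimes>\<^bsub>H\<^esub> b \<otimes>\<^bsub>H\<^esub> c"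
    using half[of z "x \<otimes> y"] y xyz by (auto simp: a_def b_def c_def G.m_assoc)
  moreover have "f (z \<otimes> x \<otimes> y) = a \<otimes>\<^bsub>H\<^esub> c \<otimes>\<^bsub>H\<^esub> b \<or> f (z \<otimes> x \<otimes> y) = b \<otimes>\<^bsub>H\<^esub> (a \<otimes>\<^bsub>H\<^esub> c)"
    using half[of "z \<otimes> x" y] zx xyz by (auto simp: b_def)
  ultimately have calc: "c \<otimes>\<^bsub>H\<^esub> (a \<otimes>\<^bsub>H\<^esub> b) = a \<otimes>\<^bsub>H\<^esub> c \<otimes>\<^bsub>H\<^esub> b \<or>
      c \<otimes>\<^bsub>H\<^esub> (a \<otimes>\<^bsub>H\<^esub> b) = b \<otimes>\<^bsub>H\<^esub> (a \<otimes>\<^bsub>H\<^esub> c) \<or>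
      a \<otimes>\<^bsub>H\<^esub> b \<otimes>\<^bsub>H\<^esub> c = a \<otimes>\<^bsub>H\<^esub> c \<otimes>\<^bsub>H\<^esub> b \<or>
      a \<otimes>\<^bsub>H\<^esub> b \<otimes>\<^bsub>H\<^esub> c = b \<otimes>\<^bsub>H\<^esub> (a \<otimes>\<^bsub>H\<^esub> c)"
    by metis
  have 2: "c \<otimes>\<^bsub>H\<^esub> (a \<otimes>\<^bsub>H\<^esub> b) = b \<otimes>\<^bsub>H\<^esub> (a \<otimes>\<^bsub>H\<^esub> c) \<or> b \<otimes>\<^bsub>H\<^esub> c = c \<otimes>\<^bsub>H\<^esub> b"
  proof -
    have "c \<otimes>\<^bsub>H\<^esub> (a \<otimes>\<^bsub>H\<^esub> b) \<noteq> a \<otimes>\<^bsub>H\<^esub> c \<otimes>\<^bsub>H\<^esub> b"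
      using ne by (simp flip: H.m_assoc)
    moreover have "a \<otimes>\<^bsub>H\<^esub> b \<otimes>\<^bsub>H\<^esub> c \<noteq> b \<otimes>\<^bsub>H\<^esub> (a \<otimes>\<^bsub>H\<^esub> c)"
      using ne by (simp flip: H.m_assoc)
    ultimately show ?thesis
      using calc by (auto simp: H.m_assoc)
  qed
  show False
    using 2
  proof
    assume e: "c \<otimes>\<^bsub>H\<^esub> (a \<otimes>\<^bsub>H\<^esub> b) = b \<otimes>\<^bsub>H\<^esub> (a \<otimes>\<^bsub>H\<^esub> c)"
    have "a \<otimes>\<^bsub>H\<^esub> (b \<otimes>\<^bsub>H\<^esub> c) \<noteq> b \<otimes>\<^bsub>H\<^esub> (a \<otimes>\<^bsub>H\<^esub> c)"
      using ne by (simp flip: H.m_assoc)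
    moreover have "b \<otimes>\<^bsub>H\<^esub> (c \<otimes>\<^bsub>H\<^esub> a) \<noteq> b \<otimes>\<^bsub>H\<^esub> (a \<otimes>\<^bsub>H\<^esub> c)"
      using ne by simp
    ultimately show False
      using 1 e by auto
  next
    assume e: "b \<otimes>\<^bsub>H\<^esub> c = c \<otimes>\<^bsub>H\<^esub> b"
    have "c \<otimes>\<^bsub>H\<^esub> (a \<otimes>\<^bsub>H\<^esub> b) \<noteq> a \<otimes>\<^bsub>H\<^esub> (b \<otimes>\<^bsub>H\<^esub> c)"
      unfolding e using ne by (simp flip: H.m_assoc)
    moreover have "b \<otimes>\<^bsub>H\<^esub> (c \<otimes>\<^bsub>H\<^esub> a) = c \<otimes>\<^bsub>H\<^esub> (b \<otimes>\<^bsub>H\<^esub> a)"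
      using e by (simp flip: H.m_assoc)
    ultimately show False
      using 1 ne by auto
  qed
qed

text \<open>Suppose that $x, y$ is a positive and $u, v$ a negative non-commuting pair.  Since the orientation is
  determined by either member of a pair, each of $x, y$ commutes with each of $u, v$.  Hence $yu$
  commutes neither with $x$ nor with $v$, and it would be oriented positively with the first and
  negatively with the second.\<close>

theorem hom_or_antihom:
  "(\<forall>x\<in>carrier G. \<forall>y\<in>carrier G. f (x \<otimes> y) = f x \<otimes>\<^bsub>H\<^esub> f y) \<or>
   (\<forall>x\<in>carrier G. \<forall>y\<in>carrier G. f (x \<otimes> y) = f y \<otimes>\<^bsub>H\<^esub> f x)"
proof (rule ccontr)
  assume "\<not> ?thesis"
  then obtain x y u v where
    mem [simp]: "x \<in> carrier G" "y \<in> carrier G" "u \<in> carrier G" "v \<in> carrier G"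
    and "f (x \<otimes> y) \<noteq> f y \<otimes>\<^bsub>H\<^esub> f x" "f (u \<otimes> v) \<noteq> f u \<otimes>\<^bsub>H\<^esub> f v"
    by blast
  then have xy: "f (x \<otimes> y) = f x \<otimes>\<^bsub>H\<^esub> f y" "x \<otimes> y \<noteq> y \<otimes> x"
    and uv: "f (u \<otimes> v) = f v \<otimes>\<^bsub>H\<^esub> f u" "u \<otimes> v \<noteq> v \<otimes> u"
    using half[of x y] half[of u v] commute_iff[of x y] commute_iff[of u v] by auto
  note yx = swap_hom[OF mem(1,2) xy(1)] xy(2)[symmetric]
  note vu = swap_antihom[OF mem(3,4) uv(1)] uv(2)[symmetric]
  have clash: "p \<otimes> q = q \<otimes> p"
    if mem: "p \<in> carrier G" "q \<in> carrier G" "r \<in> carrier G" "s \<in> carrier G"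
      and p: "f (p \<otimes> r) = f p \<otimes>\<^bsub>H\<^esub> f r" "p \<otimes> r \<noteq> r \<otimes> p"
      and q: "f (q \<otimes> s) = f s \<otimes>\<^bsub>H\<^esub> f q" "q \<otimes> s \<noteq> s \<otimes> q" for p q r s
  proof (rule ccontr)
    assume ne: "p \<otimes> q \<noteq> q \<otimes> p"
    have "f (p \<otimes> q) \<noteq> f q \<otimes>\<^bsub>H\<^esub> f p"
      using same_orientation[of p r q] mem p ne by blast
    then have "f (q \<otimes> p) = f q \<otimes>\<^bsub>H\<^esub> f p"
      using half[of p q] swap_hom[of p q] mem by blast
    then show False
      using same_orientation[of q p s] mem q ne by metis
  qed
  have comm: "x \<otimes> u = u \<otimes> x" "y \<otimes> v = v \<otimes> y"
    by (rule clash[of x u y v] clash[of y v x u]; (rule mem xy yx uv vu))+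
  define m where "m = y \<otimes> u"
  have m [simp]: "m \<in> carrier G"
    by (simp add: m_def)
  have "x \<otimes> m = x \<otimes> y \<otimes> u" "m \<otimes> x = y \<otimes> x \<otimes> u"
    unfolding m_def using comm(1) by (simp_all add: G.m_assoc)
  then have xm: "x \<otimes> m \<noteq> m \<otimes> x"
    using xy(2) by simp
  have "v \<otimes> m = y \<otimes> (v \<otimes> u)" "m \<otimes> v = y \<otimes> (u \<otimes> v)"
    unfolding m_def by (simp_all add: G.m_assoc[symmetric] comm(2))
  then have vm: "v \<otimes> m \<noteq> m \<otimes> v"
    using vu(2) by simp
  have "f (x \<otimes> m) = f x \<otimes>\<^bsub>H\<^esub> f m"
    using same_orientation[of x y m] xy xm half[of x m] mem m by blast
  then have "f (m \<otimes> x) = f m \<otimes>\<^bsub>H\<^esub> f x"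
    by (rule swap_hom[OF mem(1) m])
  moreover have "f (v \<otimes> m) = f m \<otimes>\<^bsub>H\<^esub> f v"
    using same_orientation[of v m u] vu vm half[of v m] mem m by blast
  then have "f (m \<otimes> v) = f v \<otimes>\<^bsub>H\<^esub> f m"
    by (rule swap_antihom[OF mem(4) m])
  ultimately show False
    using same_orientation[of m x v] xm vm mem m by metis
qed

end

section \<open>Product-one sequences\<close>

abbreviation product_one_seqs :: "('a, 'b) monoid_scheme \<Rightarrow> 'a multiset set" where
  "product_one_seqs G \<equiv> carrier (product_one_monoid G)"

text \<open>The order is $0$ for an element of infinite order, so its sequence is empty.\<close>

definition order_seq :: "('a, 'b) monoid_scheme \<Rightarrow> 'a \<Rightarrow> 'a multiset" where
  "order_seq G g = replicate_mset (group.ord G g) g"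

lemma product_one_seqs_iff:
  "S \<in> product_one_seqs G \<longleftrightarrow>
     (\<exists>xs. mset xs = S \<and> set xs \<subseteq> carrier G \<and> ordered_product G xs = \<one>\<^bsub>G\<^esub>)"
  by (auto simp: product_one_monoid_def sequence_monoid_def products_def
      permutations_of_multiset_def image_iff)

lemma mset_in_product_one_seqs:
  "\<lbrakk>set xs \<subseteq> carrier G; ordered_product G xs = \<one>\<^bsub>G\<^esub>\<rbrakk> \<Longrightarrow> mset xs \<in> product_one_seqs G"
  by (auto simp: product_one_seqs_iff)

lemma product_one_seqs_terms:
  "\<lbrakk>S \<in> product_one_seqs G; g \<in># S\<rbrakk> \<Longrightarrow> g \<in> carrier G"
  by (auto simp: product_one_seqs_iff)

lemma mult_product_one [simp]: "S \<otimes>\<^bsub>product_one_monoid G\<^esub> T = S + T"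
  by (simp add: product_one_monoid_def sequence_monoid_def)

lemma sum_mset_repeat_mset:
  "(\<Sum>x\<in>#repeat_mset k T. W x) = repeat_mset k (\<Sum>x\<in>#T. W x :: 'a multiset)"
  by (induction k) auto

lemma sum_mset_replicate_mset_seq:
  "(\<Sum>x\<in>#replicate_mset k g. W x) = repeat_mset k (W g :: 'a multiset)"
  by (induction k) auto

lemma repeat_mset_replicate: "repeat_mset k (replicate_mset n g) = replicate_mset (k * n) g"
  by (rule multiset_eqI) simp

lemma set_mset_repeat_mset: "k > 0 \<Longrightarrow> set_mset (repeat_mset k S) = set_mset S"
  by (auto simp flip: count_greater_zero_iff)

lemma count_sum_order_seq:
  assumes "inj_on f A" "set_mset T \<subseteq> A" "g \<in> A"
  shows "count (\<Sum>x\<in>#T. order_seq K (f x)) (f g) = count T g * group.ord K (f g)"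
  using assms(2)
proof (induction T)
  case (add x T)
  have "f x = f g \<longleftrightarrow> x = g"
    using add.prems assms by (auto dest: inj_onD)
  with add show ?case
    by (auto simp: order_seq_def)
qed simp

context group
begin

lemma empty_product_one: "{#} \<in> product_one_seqs G"
  using mset_in_product_one_seqs[of "[]" G] by (simp add: ordered_product_def)

lemma add_product_one:
  "\<lbrakk>S \<in> product_one_seqs G; T \<in> product_one_seqs G\<rbrakk> \<Longrightarrow> S + T \<in> product_one_seqs G"
  using submonoid.m_closed[OF submonoid_product_one] by (simp add: sequence_monoid_def)

lemma repeat_product_one:
  "S \<in> product_one_seqs G \<Longrightarrow> repeat_mset k S \<in> product_one_seqs G"
  by (induction k) (auto simp: empty_product_one add_product_one)

lemma sum_product_one:
  "(\<And>x. x \<in># T \<Longrightarrow> W x \<in> product_one_seqs G) \<Longrightarrow> (\<Sum>x\<in>#T. W x) \<in> product_one_seqs G"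
  by (induction T) (auto simp: empty_product_one add_product_one)

lemma ordered_product_replicate:
  "g \<in> carrier G \<Longrightarrow> ordered_product G (replicate k g) = g [^] k"
proof (induction k)
  case (Suc k)
  then show ?case
    using nat_pow_Suc2[of g k] by (simp add: ordered_product_def)
qed (simp add: ordered_product_def)

lemma replicate_product_one_iff:
  assumes "g \<in> carrier G"
  shows "replicate_mset k g \<in> product_one_seqs G \<longleftrightarrow> g [^] k = \<one>"
proof
  assume "replicate_mset k g \<in> product_one_seqs G"
  then obtain xs where xs: "mset xs = replicate_mset k g" "ordered_product G xs = \<one>"
    by (auto simp: product_one_seqs_iff)
  have "length xs = k"
    using xs(1) by (metis size_mset size_replicate_mset)
  moreover have "\<And>x. x \<in> set xs \<Longrightarrow> x = g"
    using xs(1) by (metis in_replicate_mset set_mset_mset)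
  ultimately have "xs = replicate k g"
    by (intro replicate_eqI) auto
  with xs(2) show "g [^] k = \<one>"
    using assms ordered_product_replicate by simp
next
  assume "g [^] k = \<one>"
  then show "replicate_mset k g \<in> product_one_seqs G"
    using assms mset_in_product_one_seqs[of "replicate k g" G]
    by (simp add: ordered_product_replicate set_replicate_conv_if)
qed

lemma order_seq_product_one: "g \<in> carrier G \<Longrightarrow> order_seq G g \<in> product_one_seqs G"
  by (simp add: order_seq_def replicate_product_one_iff pow_ord_eq_1)

lemma singleton_product_one_iff:
  "g \<in> carrier G \<Longrightarrow> {#g#} \<in> product_one_seqs G \<longleftrightarrow> g = \<one>"
  using replicate_product_one_iff[of g 1] by simp

lemma pair_product_one:
  "\<lbrakk>x \<in> carrier G; y \<in> carrier G; x \<otimes> y = \<one>\<rbrakk> \<Longrightarrow> {#x, y#} \<in> product_one_seqs G"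
  using mset_in_product_one_seqs[of "[x, y]" G] by (simp add: ordered_product_def)

lemma triple_product_one:
  "\<lbrakk>x \<in> carrier G; y \<in> carrier G; z \<in> carrier G; x \<otimes> (y \<otimes> z) = \<one>\<rbrakk>
    \<Longrightarrow> {#x, y, z#} \<in> product_one_seqs G"
  using mset_in_product_one_seqs[of "[x, y, z]" G] by (simp add: ordered_product_def)

lemma pair_product_oneD:
  assumes xy: "{#x, y#} \<in> product_one_seqs G"
  shows "y = inv x"
proof -
  have mem: "x \<in> carrier G" "y \<in> carrier G"
    using product_one_seqs_terms[OF xy] by auto
  obtain zs where zs: "mset zs = {#x, y#}" "ordered_product G zs = \<one>"
    using xy by (auto simp: product_one_seqs_iff)
  then have "length zs = 2"
    by (metis One_nat_def Suc_1 size_add_mset size_mset size_single)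
  then obtain p q where pq: "zs = [p, q]"
    by (auto simp: length_Suc_conv numeral_2_eq_2)
  then have "x = p \<and> y = q \<or> x = q \<and> y = p"
    using zs(1) by (auto simp: add_eq_conv_ex)
  moreover have "p \<otimes> q = \<one>"
    using zs(2) pq mem calculation by (auto simp: ordered_product_def)
  ultimately have "x \<otimes> y = \<one> \<or> y \<otimes> x = \<one>"
    by blast
  then have "inv y = x \<or> inv x = y"
    using mem inv_equality[of x y] inv_equality[of y x] by blast
  then show ?thesis
    using mem inv_inv[of y] by metis
qed

text \<open>Rotating reduces the six orderings of three terms to the two cyclic ones.\<close>

lemma rotate_product_one:
  assumes "x \<in> carrier G" "y \<in> carrier G" "z \<in> carrier G" "x \<otimes> (y \<otimes> z) = \<one>"
  shows "y \<otimes> (z \<otimes> x) = \<one>"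
  using assms by (metis m_assoc m_closed inv_unique' r_inv inv_closed inv_equality inv_inv)

lemma triple_product_oneD:
  assumes xyz: "{#x, y, inv w#} \<in> product_one_seqs G" and w: "w \<in> carrier G"
  shows "w = x \<otimes> y \<or> w = y \<otimes> x"
proof -
  have mem: "x \<in> carrier G" "y \<in> carrier G"
    using product_one_seqs_terms[OF xyz] by auto
  define v where "v = inv w"
  have v: "v \<in> carrier G"
    using w by (simp add: v_def)
  obtain zs where zs: "mset zs = {#x, y, v#}" "ordered_product G zs = \<one>"
    using xyz by (auto simp: product_one_seqs_iff v_def)
  then have "length zs = 3"
    by (metis One_nat_def Suc_1 size_add_mset size_mset size_single numeral_3_eq_3)
  then obtain p q r where pqr: "zs = [p, q, r]"
    by (auto simp: length_Suc_conv numeral_3_eq_3)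
  have perm: "p = x \<and> q = y \<and> r = v \<or> p = y \<and> q = v \<and> r = x \<or> p = v \<and> q = x \<and> r = y \<or>
      p = y \<and> q = x \<and> r = v \<or> p = x \<and> q = v \<and> r = y \<or> p = v \<and> q = y \<and> r = x"
    using zs(1) pqr by (auto simp: add_eq_conv_ex)
  then have "p \<otimes> (q \<otimes> r) = \<one>" "p \<in> carrier G" "q \<in> carrier G" "r \<in> carrier G"
    using zs(2) pqr mem v by (auto simp: ordered_product_def)
  then have "x \<otimes> (y \<otimes> v) = \<one> \<or> y \<otimes> (x \<otimes> v) = \<one>"
    using perm rotate_product_one[of p q r] rotate_product_one[of q r p] by blast
  then have "x \<otimes> y \<otimes> v = \<one> \<or> y \<otimes> x \<otimes> v = \<one>"
    using mem v by (simp add: m_assoc)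
  then have "inv v = x \<otimes> y \<or> inv v = y \<otimes> x"
    using mem v inv_equality[of _ v] m_closed by blast
  then show ?thesis
    using w by (simp add: v_def)
qed

lemma torsion_ord_pos:
  "\<lbrakk>torsion_group G; g \<in> carrier G\<rbrakk> \<Longrightarrow> ord g > 0"
  using ord_eq_0[of g] unfolding torsion_group_def by (metis gr0I less_numeral_extra(3))

text \<open>Multiplying by a common multiple of the orders of the terms makes every multiplicity divisible by
  the order of the term.\<close>

lemma torsion_multiple_eq_sum_order_seqs:
  assumes tor: "torsion_group G" and "set_mset S \<subseteq> carrier G"
  obtains N T where "N > 0" "set_mset T \<subseteq> carrier G"
    "repeat_mset N S = (\<Sum>x\<in>#T. order_seq G x)"
  using assms(2)
proof (induction S arbitrary: thesis)
  case empty
  show ?case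
    by (rule empty(1)[of 1 "{#}"]) auto
next
  case (add g S)
  obtain N T where NT: "N > 0" "set_mset T \<subseteq> carrier G"
    "repeat_mset N S = (\<Sum>x\<in>#T. order_seq G x)"
    using add.IH add.prems(2) by auto
  let ?n = "ord g"
  have "repeat_mset (N * ?n) (add_mset g S)
      = repeat_mset N (order_seq G g) + repeat_mset ?n (repeat_mset N S)"
    by (simp add: order_seq_def repeat_mset_replicate mult.commute)
  also have "\<dots> = (\<Sum>x\<in>#replicate_mset N g + repeat_mset ?n T. order_seq G x)"
    by (simp only: NT(3) image_mset_union sum_mset.union sum_mset_repeat_mset
        sum_mset_replicate_mset_seq)
  finally have eq: "repeat_mset (N * ?n) (add_mset g S)
      = (\<Sum>x\<in>#replicate_mset N g + repeat_mset ?n T. order_seq G x)" .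
  have pos: "?n > 0"
    using torsion_ord_pos[OF tor, of g] add.prems(2) by simp
  show ?case
  proof (rule add.prems(1)[OF _ _ eq])
    show "0 < N * ?n"
      using NT(1) pos by simp
    show "set_mset (replicate_mset N g + repeat_mset ?n T) \<subseteq> carrier G"
      using NT(1,2) pos add.prems(2) by (simp add: set_mset_repeat_mset)
  qed
qed

text \<open>The identity is a sequence by itself, and an element $g$ with $g \neq g^{-1}$ is balanced by its
  inverse.  An involution has to be split as $g = h \cdot h^{-1}g$ with both factors different from $g$, which
  needs a third element $h$; in a group of order two the statement fails.\<close>

lemma ex_product_one_count_1:
  assumes big: "\<And>a b. \<not> carrier G \<subseteq> {a, b}" and g: "g \<in> carrier G"
  obtains S where "S \<in> product_one_seqs G" "count S g = 1"
proof -
  consider "g = \<one>" | "inv g \<noteq> g" | "g \<noteq> \<one>" "inv g = g" by blast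
  then show ?thesis
  proof cases
    case 1
    then show ?thesis
      by (intro that[of "{#g#}"]) (simp_all add: singleton_product_one_iff)
  next
    case 2
    then show ?thesis
      using g by (intro that[of "{#g, inv g#}"] pair_product_one) auto
  next
    case 3
    obtain h where h: "h \<in> carrier G" "h \<noteq> \<one>" "h \<noteq> g"
      using big[of \<one> g] by blast
    have "g \<otimes> g = \<one>"
      using 3 g by (metis r_inv)
    then have "g \<otimes> (h \<otimes> (inv h \<otimes> g)) = \<one>"
      using g h by (simp flip: m_assoc)
    moreover have "inv h \<otimes> g \<noteq> g"
      using g h by simp
    ultimately show ?thesis
      using g h by (intro that[of "{#g, h, inv h \<otimes> g#}"] triple_product_one) auto
  qed
qed

end

section \<open>Isomorphisms between monoids of product-one sequences\<close>

locale product_one_iso = G: group G + H: group H for G (structure) and H (structure) +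
  fixes \<Phi>
  assumes bij: "bij_betw \<Phi> (product_one_seqs G) (product_one_seqs H)"
    and add: "\<lbrakk>S \<in> product_one_seqs G; T \<in> product_one_seqs G\<rbrakk> \<Longrightarrow> \<Phi> (S + T) = \<Phi> S + \<Phi> T"
begin

lemma closed: "S \<in> product_one_seqs G \<Longrightarrow> \<Phi> S \<in> product_one_seqs H"
  using bij by (rule bij_betwE[THEN bspec])

abbreviation \<Psi> where "\<Psi> \<equiv> inv_into (product_one_seqs G) \<Phi>"

lemma \<Phi>_\<Psi>: "S \<in> product_one_seqs H \<Longrightarrow> \<Phi> (\<Psi> S) = S"
  using bij by (rule bij_betw_inv_into_right)

lemma \<Psi>_\<Phi>: "S \<in> product_one_seqs G \<Longrightarrow> \<Psi> (\<Phi> S) = S"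
  using bij by (rule bij_betw_inv_into_left)

lemma inverse: "product_one_iso H G \<Psi>"
proof unfold_locales
  show bij': "bij_betw \<Psi> (product_one_seqs H) (product_one_seqs G)"
    using bij by (rule bij_betw_inv_into)
  fix S T
  assume ST: "S \<in> product_one_seqs H" "T \<in> product_one_seqs H"
  then have mem: "\<Psi> S \<in> product_one_seqs G" "\<Psi> T \<in> product_one_seqs G"
    using bij' by (auto dest: bij_betwE)
  have "\<Phi> (\<Psi> S + \<Psi> T) = S + T"
    using add[OF mem] ST by (simp add: \<Phi>_\<Psi>)
  then show "\<Psi> (S + T) = \<Psi> S + \<Psi> T"
    using \<Psi>_\<Phi>[OF G.add_product_one[OF mem]] by simp
qed

lemma empty: "\<Phi> {#} = {#}"
  using add[OF G.empty_product_one G.empty_product_one] by simp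

lemma eq_empty_iff: "S \<in> product_one_seqs G \<Longrightarrow> \<Phi> S = {#} \<longleftrightarrow> S = {#}"
  using empty \<Psi>_\<Phi> G.empty_product_one by metis

lemma repeat: "S \<in> product_one_seqs G \<Longrightarrow> \<Phi> (repeat_mset k S) = repeat_mset k (\<Phi> S)"
  by (induction k) (auto simp: empty add G.repeat_product_one)

lemma sum_order_seqs:
  "set_mset T \<subseteq> carrier G \<Longrightarrow>
    \<Phi> (\<Sum>x\<in>#T. order_seq G x) = (\<Sum>x\<in>#T. \<Phi> (order_seq G x))"
proof (induction T)
  case (add x T)
  then show ?case
    using product_one_iso.add[OF product_one_iso_axioms, of "order_seq G x"]
      G.order_seq_product_one[of x] G.sum_product_one[of T "order_seq G"]
      G.order_seq_product_one
    by (auto simp: subset_iff)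
qed (simp add: empty)

text \<open>Since $g$ occurs in $S$, a positive multiple of $S$ is $U_g$ plus a further product-one sequence, and
  $\Phi$ preserves this decomposition.\<close>

lemma support_order_seq:
  assumes tor: "torsion_group G" and S: "S \<in> product_one_seqs G" and g: "g \<in># S"
  shows "set_mset (\<Phi> (order_seq G g)) \<subseteq> set_mset (\<Phi> S)"
proof -
  have "set_mset S \<subseteq> carrier G"
    using product_one_seqs_terms[OF S] by blast
  then obtain N T where N: "N > 0" and T: "set_mset T \<subseteq> carrier G"
    and eq: "repeat_mset N S = (\<Sum>x\<in>#T. order_seq G x)"
    using G.torsion_multiple_eq_sum_order_seqs[OF tor] by blast
  have "g \<in># repeat_mset N S"
    using N g by (simp add: set_mset_repeat_mset)
  then have "g \<in># T"
    by (auto simp: eq order_seq_def split: if_splits)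
  then have "set_mset (\<Phi> (order_seq G g)) \<subseteq> set_mset (\<Sum>x\<in>#T. \<Phi> (order_seq G x))"
    by auto
  also have "(\<Sum>x\<in>#T. \<Phi> (order_seq G x)) = repeat_mset N (\<Phi> S)"
    using sum_order_seqs[OF T] repeat[OF S, of N] eq by simp
  finally show ?thesis
    using N by (simp add: set_mset_repeat_mset)
qed

lemma order_seq_image_nonempty:
  assumes "torsion_group G" "g \<in> carrier G"
  shows "\<Phi> (order_seq G g) \<noteq> {#}"
proof -
  have "order_seq G g \<noteq> {#}"
    using G.torsion_ord_pos[OF assms]
    by (simp add: order_seq_def size_eq_0_iff_empty[symmetric] del: size_eq_0_iff_empty)
  then show ?thesis
    using eq_empty_iff[OF G.order_seq_product_one[OF assms(2)]] by simp
qed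

text \<open>If $h$ has infinite order and $k = h^{-1}$, the sequences $P = h k$, $Q = h^2 \cdot k^2$,
  $A = h\, h\, k^2$ and $C = k\, k\, h^2$ satisfy the relation $2P + Q = A + C$.  Hence some $g$ occurs in
  the preimage of $P$ and in that of $A$ or $C$.  The terms of $\Phi(U_g)$ then all lie in the
  intersection of the supports, which is $\{h\}$ or $\{k\}$.  But a nonempty sequence repeating an
  element of infinite order is not product-one.\<close>

lemma torsion_codomain:
  assumes tor: "torsion_group G"
  shows "torsion_group H"
proof (rule ccontr)
  assume "\<not> torsion_group H"
  then obtain h where h: "h \<in> carrier H" "\<And>n::nat. n > 0 \<Longrightarrow> h [^]\<^bsub>H\<^esub> n \<noteq> \<one>\<^bsub>H\<^esub>"
    unfolding torsion_group_def using H.group_axioms by blast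
  define k where "k = inv\<^bsub>H\<^esub> h"
  have k: "k \<in> carrier H" "h \<otimes>\<^bsub>H\<^esub> k = \<one>\<^bsub>H\<^esub>" "k \<otimes>\<^bsub>H\<^esub> h = \<one>\<^bsub>H\<^esub>"
    using h by (auto simp: k_def)
  have k_pow: "k [^]\<^bsub>H\<^esub> n \<noteq> \<one>\<^bsub>H\<^esub>" if "n > 0" for n :: nat
    using h that by (simp add: k_def H.nat_pow_inv)
  have ne: "h \<noteq> \<one>\<^bsub>H\<^esub>" "k \<noteq> \<one>\<^bsub>H\<^esub>" "h \<noteq> k"
    using h(2)[of 1] h(2)[of 2] k_pow[of 1] h(1) k by (auto simp: numeral_2_eq_2)
  define P Q A C where "P = {#h, k#}" and "Q = {#h \<otimes>\<^bsub>H\<^esub> h, k \<otimes>\<^bsub>H\<^esub> k#}"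
    and "A = {#h, h, k \<otimes>\<^bsub>H\<^esub> k#}" and "C = {#k, k, h \<otimes>\<^bsub>H\<^esub> h#}"
  have hhkk: "h \<otimes>\<^bsub>H\<^esub> (h \<otimes>\<^bsub>H\<^esub> (k \<otimes>\<^bsub>H\<^esub> k)) = \<one>\<^bsub>H\<^esub>" "k \<otimes>\<^bsub>H\<^esub> (k \<otimes>\<^bsub>H\<^esub> (h \<otimes>\<^bsub>H\<^esub> h)) = \<one>\<^bsub>H\<^esub>"
  proof -
    have "h \<otimes>\<^bsub>H\<^esub> (k \<otimes>\<^bsub>H\<^esub> k) = k" "k \<otimes>\<^bsub>H\<^esub> (h \<otimes>\<^bsub>H\<^esub> h) = h"
      using h(1) k by (simp_all flip: H.m_assoc)
    then show "h \<otimes>\<^bsub>H\<^esub> (h \<otimes>\<^bsub>H\<^esub> (k \<otimes>\<^bsub>H\<^esub> k)) = \<one>\<^bsub>H\<^esub>" "k \<otimes>\<^bsub>H\<^esub> (k \<otimes>\<^bsub>H\<^esub> (h \<otimes>\<^bsub>H\<^esub> h)) = \<one>\<^bsub>H\<^esub>"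
      using k by simp_all
  qed
  have mem: "P \<in> product_one_seqs H" "Q \<in> product_one_seqs H"
      "A \<in> product_one_seqs H" "C \<in> product_one_seqs H"
    unfolding P_def Q_def A_def C_def using h(1) k hhkk
    by (auto intro!: H.pair_product_one H.triple_product_one simp: H.m_assoc)
  interpret I: product_one_iso H G \<Psi>
    by (rule inverse)
  have "P + P + Q = A + C"
    by (simp add: P_def Q_def A_def C_def)
  then have split: "\<Psi> P + \<Psi> P + \<Psi> Q = \<Psi> A + \<Psi> C"
    using mem by (metis I.add H.add_product_one)
  have "\<Psi> P \<noteq> {#}"
    using I.eq_empty_iff[OF mem(1)] by (simp add: P_def)
  then obtain g where g: "g \<in># \<Psi> P"
    by (rule multiset_nonemptyE)
  have gG: "g \<in> carrier G"
    by (rule product_one_seqs_terms[OF I.closed[OF mem(1)] g])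
  define W where "W = \<Phi> (order_seq G g)"
  have W: "W \<in> product_one_seqs H" "W \<noteq> {#}"
    using gG order_seq_image_nonempty[OF tor gG] closed[OF G.order_seq_product_one]
    by (auto simp: W_def)
  have supp: "set_mset W \<subseteq> set_mset X" if "X \<in> product_one_seqs H" "g \<in># \<Psi> X" for X
    using support_order_seq[OF tor I.closed that(2)] that by (simp add: W_def \<Phi>_\<Psi>)
  have single: False if "set_mset W \<subseteq> {x}" "x \<in> carrier H" "\<And>n::nat. n > 0 \<Longrightarrow> x [^]\<^bsub>H\<^esub> n \<noteq> \<one>\<^bsub>H\<^esub>" for x
    using set_mset_subset_singletonD[OF that(1)] W H.replicate_product_one_iff[OF that(2)] that(3)
    by (metis nonempty_has_size)
  have "g \<in># \<Psi> A \<or> g \<in># \<Psi> C"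
    using g split by (metis union_iff)
  then show False
  proof
    assume "g \<in># \<Psi> A"
    then have "set_mset W \<subseteq> set_mset P \<inter> set_mset A"
      using supp mem g by blast
    also have "\<dots> = {h}"
      using ne h(1) k by (auto simp: P_def A_def)
    finally show False
      using single h by blast
  next
    assume "g \<in># \<Psi> C"
    then have "set_mset W \<subseteq> set_mset P \<inter> set_mset C"
      using supp mem g by blast
    also have "\<dots> = {k}"
      using ne h(1) k by (auto simp: P_def C_def)
    finally show False
      using single k k_pow by blast
  qed
qed

text \<open>Let $h$ be a term of $V = \Phi(U_g)$.  The support of $\Phi^{-1}(U_h)$ lies in that of
  $\Phi^{-1}(V) = U_g$, so $\Phi^{-1}(U_h)$ is a multiple of $U_g$ and $U_h$ is a multiple of $V$.
  Therefore $V$ repeats $h$ only, and as it is product-one it is also a multiple of $U_h$.\<close>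

lemma order_seq_image:
  assumes tor: "torsion_group G" and g: "g \<in> carrier G"
  shows "\<exists>h\<in>carrier H. \<Phi> (order_seq G g) = order_seq H h"
proof -
  interpret I: product_one_iso H G \<Psi>
    by (rule inverse)
  have torH: "torsion_group H"
    by (rule torsion_codomain[OF tor])
  define V where "V = \<Phi> (order_seq G g)"
  have U: "order_seq G g \<in> product_one_seqs G"
    by (rule G.order_seq_product_one[OF g])
  have V: "V \<in> product_one_seqs H" "V \<noteq> {#}"
    using closed[OF U] order_seq_image_nonempty[OF tor g] by (auto simp: V_def)
  obtain h where h: "h \<in># V"
    using V(2) by (rule multiset_nonemptyE)
  have hH: "h \<in> carrier H"
    by (rule product_one_seqs_terms[OF V(1) h])
  define Y where "Y = \<Psi> (order_seq H h)"
  have Y: "Y \<in> product_one_seqs G" "Y \<noteq> {#}"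
    using I.closed[OF H.order_seq_product_one[OF hH]] I.order_seq_image_nonempty[OF torH hH]
    by (auto simp: Y_def)
  have "set_mset Y \<subseteq> set_mset (\<Psi> V)"
    unfolding Y_def by (rule I.support_order_seq[OF torH V(1) h])
  also have "\<dots> \<subseteq> {g}"
    unfolding V_def \<Psi>_\<Phi>[OF U] by (simp add: order_seq_def)
  finally have Y_rep: "Y = replicate_mset (size Y) g"
    by (rule set_mset_subset_singletonD)
  then have "G.ord g dvd size Y"
    using Y(1) G.replicate_product_one_iff[OF g] G.pow_eq_id[OF g] by metis
  then obtain j where j: "size Y = j * G.ord g"
    by (metis dvd_div_mult_self)
  then have "Y = repeat_mset j (order_seq G g)"
    using Y_rep by (simp add: order_seq_def repeat_mset_replicate)
  then have W: "order_seq H h = repeat_mset j V"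
    using repeat[OF U, of j] \<Phi>_\<Psi>[OF H.order_seq_product_one[OF hH]] by (simp add: Y_def V_def)
  have "j > 0"
    using Y(2) j by (intro gr0I) auto
  then have "set_mset V \<subseteq> {h}"
    using set_mset_repeat_mset[of j V] unfolding W[symmetric] by (simp add: order_seq_def split: if_splits)
  then have V_rep: "V = replicate_mset (size V) h"
    by (rule set_mset_subset_singletonD)
  then have "H.ord h dvd size V"
    using V(1) H.replicate_product_one_iff[OF hH] H.pow_eq_id[OF hH] by metis
  moreover have "H.ord h = j * size V"
    using arg_cong[OF W, of size] by (simp add: order_seq_def)
  ultimately have "size V = H.ord h"
    by (metis dvd_antisym dvd_triv_right)
  then have "V = order_seq H h"
    using V_rep by (simp add: order_seq_def)
  then show ?thesis
    using hH by (intro bexI[of _ h]) (simp_all add: V_def)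
qed

lemma ex_order_seq_bij:
  assumes tor: "torsion_group G"
  obtains f where "bij_betw f (carrier G) (carrier H)"
    "\<And>g. g \<in> carrier G \<Longrightarrow> \<Phi> (order_seq G g) = order_seq H (f g)"
proof -
  interpret I: product_one_iso H G \<Psi>
    by (rule inverse)
  have torH: "torsion_group H"
    by (rule torsion_codomain[OF tor])
  obtain f where f: "\<And>g. g \<in> carrier G \<Longrightarrow> f g \<in> carrier H"
    "\<And>g. g \<in> carrier G \<Longrightarrow> \<Phi> (order_seq G g) = order_seq H (f g)"
    using order_seq_image[OF tor] by metis
  obtain e where e: "\<And>h. h \<in> carrier H \<Longrightarrow> e h \<in> carrier G"
    "\<And>h. h \<in> carrier H \<Longrightarrow> \<Psi> (order_seq H h) = order_seq G (e h)"
    using I.order_seq_image[OF torH] by metis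
  have "e (f g) = g" if g: "g \<in> carrier G" for g
  proof -
    have "order_seq G (e (f g)) = order_seq G g"
      using e(2)[OF f(1)[OF g]] f(2)[OF g] \<Psi>_\<Phi>[OF G.order_seq_product_one[OF g]] by simp
    then show ?thesis
      using G.torsion_ord_pos[OF tor g] by (simp add: order_seq_def replicate_mset_eq_iff)
  qed
  moreover have "f (e h) = h" if h: "h \<in> carrier H" for h
  proof -
    have "order_seq H (f (e h)) = order_seq H h"
      using f(2)[OF e(1)[OF h]] e(2)[OF h] \<Phi>_\<Psi>[OF H.order_seq_product_one[OF h]] by simp
    then show ?thesis
      using H.torsion_ord_pos[OF torH h] by (simp add: order_seq_def replicate_mset_eq_iff)
  qed
  ultimately have "bij_betw f (carrier G) (carrier H)"
    using f(1) e(1) by (intro bij_betw_byWitness[where f' = e]) auto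
  then show ?thesis
    using that f(2) by blast
qed

text \<open>It suffices to compare multiplicities after passing to a multiple of $S$ that is a sum of sequences
  $U_x$, where the coefficient of $U_g$ becomes that of $U_{f(g)}$.\<close>

lemma count_image:
  assumes tor: "torsion_group G" and f: "bij_betw f (carrier G) (carrier H)"
    and f_seq: "\<And>g. g \<in> carrier G \<Longrightarrow> \<Phi> (order_seq G g) = order_seq H (f g)"
    and S: "S \<in> product_one_seqs G" and g: "g \<in> carrier G"
  shows "count (\<Phi> S) (f g) * G.ord g = count S g * H.ord (f g)"
proof -
  have "set_mset S \<subseteq> carrier G"
    using product_one_seqs_terms[OF S] by blast
  then obtain N T where N: "N > 0" and T: "set_mset T \<subseteq> carrier G"
    and eq: "repeat_mset N S = (\<Sum>x\<in>#T. order_seq G x)"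
    using G.torsion_multiple_eq_sum_order_seqs[OF tor] by blast
  have "N * count S g = count T g * G.ord g"
    using arg_cong[OF eq, of "\<lambda>X. count X g"]
      count_sum_order_seq[of "\<lambda>x. x" "carrier G" T g G] T g by simp
  moreover have "N * count (\<Phi> S) (f g) = count T g * H.ord (f g)"
  proof -
    have "image_mset (\<lambda>x. \<Phi> (order_seq G x)) T = image_mset (\<lambda>x. order_seq H (f x)) T"
      using T f_seq by (intro image_mset_cong) auto
    then have "repeat_mset N (\<Phi> S) = (\<Sum>x\<in>#T. order_seq H (f x))"
      using sum_order_seqs[OF T] repeat[OF S, of N] eq by simp
    from arg_cong[OF this, of "\<lambda>X. count X (f g)"] show ?thesis
      using count_sum_order_seq[OF bij_betw_imp_inj_on[OF f] T g, of H] by simp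
  qed
  ultimately have "N * (count (\<Phi> S) (f g) * G.ord g) = N * (count S g * H.ord (f g))"
    by (metis mult.assoc mult.commute)
  then show ?thesis
    using N by simp
qed

text \<open>A sequence that contains $g$ exactly once shows that $\mathrm{ord}(g)$ divides
  $\mathrm{ord}(f(g))$, and the preimage of one that contains $f(g)$ exactly once shows the converse
  divisibility.\<close>

lemma ord_eq:
  assumes tor: "torsion_group G" and f: "bij_betw f (carrier G) (carrier H)"
    and f_seq: "\<And>g. g \<in> carrier G \<Longrightarrow> \<Phi> (order_seq G g) = order_seq H (f g)"
    and big: "\<And>a b. \<not> carrier G \<subseteq> {a, b}" and g: "g \<in> carrier G"
  shows "H.ord (f g) = G.ord g"
proof (rule antisym)
  have fg: "f g \<in> carrier H"
    using f g by (auto dest: bij_betwE)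
  have pos: "G.ord g > 0" "H.ord (f g) > 0"
    using G.torsion_ord_pos[OF tor g] H.torsion_ord_pos[OF torsion_codomain[OF tor] fg] by auto
  obtain S where S: "S \<in> product_one_seqs G" "count S g = 1"
    using G.ex_product_one_count_1[OF big g] by blast
  then have eq: "count (\<Phi> S) (f g) * G.ord g = H.ord (f g)"
    using count_image[OF tor f f_seq S(1) g] by simp
  then show "G.ord g \<le> H.ord (f g)"
    using pos by (metis dvd_imp_le dvd_triv_right)
  have "\<not> carrier H \<subseteq> {a, b}" for a b
  proof
    assume ab: "carrier H \<subseteq> {a, b}"
    have "carrier G \<subseteq> {inv_into (carrier G) f a, inv_into (carrier G) f b}"
    proof
      fix x assume x: "x \<in> carrier G"
      then have "f x \<in> {a, b}"
        using ab f by (auto dest: bij_betwE)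
      then show "x \<in> {inv_into (carrier G) f a, inv_into (carrier G) f b}"
        using bij_betw_inv_into_left[OF f x] by auto
    qed
    then show False
      using big by blast
  qed
  then obtain T where T: "T \<in> product_one_seqs H" "count T (f g) = 1"
    using H.ex_product_one_count_1[OF _ fg] by blast
  interpret I: product_one_iso H G \<Psi>
    by (rule inverse)
  have "G.ord g = count (\<Psi> T) g * H.ord (f g)"
    using count_image[OF tor f f_seq I.closed[OF T(1)] g] T by (simp add: \<Phi>_\<Psi>)
  then show "H.ord (f g) \<le> G.ord g"
    using pos by (metis dvd_imp_le dvd_triv_right)
qed

lemma eq_image_mset:
  assumes tor: "torsion_group G" and f: "bij_betw f (carrier G) (carrier H)"
    and f_seq: "\<And>g. g \<in> carrier G \<Longrightarrow> \<Phi> (order_seq G g) = order_seq H (f g)"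
    and big: "\<And>a b. \<not> carrier G \<subseteq> {a, b}" and S: "S \<in> product_one_seqs G"
  shows "\<Phi> S = image_mset f S"
proof (rule multiset_eqI)
  fix y
  have SG: "set_mset S \<subseteq> carrier G"
    using product_one_seqs_terms[OF S] by blast
  show "count (\<Phi> S) y = count (image_mset f S) y"
  proof (cases "y \<in> carrier H")
    case True
    then obtain g where g: "g \<in> carrier G" "y = f g"
      using f by (auto simp: bij_betw_def)
    have "count (\<Phi> S) (f g) = count S g"
      using count_image[OF tor f f_seq S g(1)] ord_eq[OF tor f f_seq big g(1)]
        G.torsion_ord_pos[OF tor g(1)] by simp
    moreover have "f -` {f g} \<inter> set_mset S = {g} \<inter> set_mset S"
      using SG g(1) bij_betw_imp_inj_on[OF f] by (auto dest: inj_onD)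
    then have "count (image_mset f S) (f g) = count S g"
      by (cases "g \<in># S") (simp_all add: count_image_mset not_in_iff)
    ultimately show ?thesis
      using g(2) by simp
  next
    case False
    then have "y \<notin># \<Phi> S" "y \<notin># image_mset f S"
      using product_one_seqs_terms[OF closed[OF S]] SG f by (auto dest: bij_betwE)
    then show ?thesis
      unfolding not_in_iff by (rule trans[OF _ sym])
  qed
qed

end

section \<open>From sequences to groups\<close>

text \<open>A product-one sequence of length two consists of mutually inverse elements, so $f$ commutes with
  inversion; the six orderings of a product-one sequence with terms $a$, $b$, $w^{-1}$ leave, up to
  rotation, only the products $abw^{-1}$ and $baw^{-1}$.\<close>

lemma half_homomorphismI:
  fixes G (structure) and H (structure)
  assumes "group G" and "group H"
    and f: "bij_betw f (carrier G) (carrier H)"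
    and im: "\<And>S. S \<in> product_one_seqs G \<Longrightarrow> image_mset f S \<in> product_one_seqs H"
  shows "injective_half_homomorphism G H f"
proof -
  interpret G: group G by fact
  interpret H: group H by fact
  show ?thesis
  proof unfold_locales
    show f_closed: "f x \<in> carrier H" if "x \<in> carrier G" for x
      using f that by (auto dest: bij_betwE)
    show "inj_on f (carrier G)"
      using f by (rule bij_betw_imp_inj_on)
    have f_inv: "f (inv x) = inv\<^bsub>H\<^esub> f x" if x: "x \<in> carrier G" for x
      using im[OF G.pair_product_one[of x "inv x"]] x by (auto intro: H.pair_product_oneD)
    fix x y assume xy: "x \<in> carrier G" "y \<in> carrier G"
    have "{#x, y, inv (x \<otimes> y)#} \<in> product_one_seqs G"
      using xy by (intro G.triple_product_one) (auto simp flip: G.m_assoc)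
    from im[OF this] have "{#f x, f y, inv\<^bsub>H\<^esub> f (x \<otimes> y)#} \<in> product_one_seqs H"
      using xy by (simp add: f_inv)
    then show "f (x \<otimes> y) = f x \<otimes>\<^bsub>H\<^esub> f y \<or> f (x \<otimes> y) = f y \<otimes>\<^bsub>H\<^esub> f x"
      using xy by (intro H.triple_product_oneD f_closed) auto
  qed
qed

lemma (in injective_half_homomorphism) bij_imp_iso:
  assumes bij: "bij_betw f (carrier G) (carrier H)"
  shows "G \<cong> H"
  using hom_or_antihom
proof
  assume "\<forall>x\<in>carrier G. \<forall>y\<in>carrier G. f (x \<otimes> y) = f x \<otimes>\<^bsub>H\<^esub> f y"
  then have "f \<in> iso G H"
    using bij by (auto simp: iso_def hom_def)
  then show ?thesis
    by (rule is_isoI)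
next
  assume anti: "\<forall>x\<in>carrier G. \<forall>y\<in>carrier G. f (x \<otimes> y) = f y \<otimes>\<^bsub>H\<^esub> f x"
  have "bij_betw (m_inv G) (carrier G) (carrier G)"
    by (intro bij_betw_byWitness[where f' = "m_inv G"]) auto
  then have "bij_betw (f \<circ> m_inv G) (carrier G) (carrier H)"
    using bij by (rule bij_betw_trans)
  then have "f \<circ> m_inv G \<in> iso G H"
    using anti by (auto simp: iso_def hom_def G.inv_mult_group)
  then show ?thesis
    by (rule is_isoI)
qed

text \<open>Groups with at most two elements need a separate argument because the bijection $f$ need not be a
  homomorphism there: over a group $\{1, g\}$ of order two the monoid is free on the sequence $1$ and
  the sequence $g\,g$, and $\Phi$ may exchange them.\<close>

lemma small_groups_iso:
  fixes G (structure) and H (structure)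
  assumes "group G" and "group H"
    and small: "carrier G \<subseteq> {a, b}" and bij: "bij_betw f (carrier G) (carrier H)"
  shows "G \<cong> H"
proof -
  interpret G: group G by fact
  interpret H: group H by fact
  obtain x where x: "carrier G = {\<one>, x}"
    using small G.one_closed by blast
  have image: "carrier H = {f \<one>, f x}"
    using bij x by (simp add: bij_betw_def)
  with H.one_closed have "\<one>\<^bsub>H\<^esub> = f \<one> \<or> \<one>\<^bsub>H\<^esub> = f x"
    by blast
  then obtain y where y: "carrier H = {\<one>\<^bsub>H\<^esub>, y}"
    using image by (metis insert_commute)
  have "card (carrier G) = card (carrier H)"
    using bij by (rule bij_betw_same_card)
  then have triv: "x = \<one> \<longleftrightarrow> y = \<one>\<^bsub>H\<^esub>"
    using x y by (auto simp: card_insert_if split: if_splits)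
  have xx: "x \<otimes> x = \<one>"
    using G.m_closed[of x x] G.l_cancel_one[of x x] x by auto
  have yy: "y \<otimes>\<^bsub>H\<^esub> y = \<one>\<^bsub>H\<^esub>"
    using H.m_closed[of y y] H.l_cancel_one[of y y] y by auto
  \<comment> \<open>The given bijection need not preserve the identity, so a new one is chosen that does.\<close>
  define p where "p = (\<lambda>g. if g = \<one> then \<one>\<^bsub>H\<^esub> else y)"
  have "p \<in> hom G H"
    unfolding hom_def p_def using x y xx yy triv G.m_closed[of x x] H.one_closed by auto
  moreover have "bij_betw p (carrier G) (carrier H)"
    unfolding bij_betw_def inj_on_def p_def using x y triv by auto
  ultimately show ?thesis
    by (intro is_isoI[of p]) (simp add: iso_def)
qed

lemma (in group_hom) image_mset_product_one:
  assumes "S \<in> product_one_seqs G"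
  shows "image_mset h S \<in> product_one_seqs H"
proof -
  obtain xs where xs: "mset xs = S" "set xs \<subseteq> carrier G" "ordered_product G xs = \<one>"
    using assms by (auto simp: product_one_seqs_iff)
  have "ordered_product H (map h xs) = h (ordered_product G xs)"
    using xs(2)
  proof (induction xs)
    case (Cons x xs)
    then show ?case
      using G.ordered_product_closed[of xs] by (simp add: ordered_product_def)
  qed (simp add: ordered_product_def)
  then have "mset (map h xs) \<in> product_one_seqs H"
    using xs(2,3) by (intro mset_in_product_one_seqs) auto
  then show ?thesis
    using xs(1) by simp
qed

lemma iso_imp_product_one_monoid_iso:
  assumes "group G" and "group H" and "G \<cong> H"
  shows "product_one_monoid G \<cong> product_one_monoid H"
proof -
  note map = group_hom.image_mset_product_one[OF group_hom.intro[OF _ _ group_hom_axioms.intro]]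
  obtain p where p: "p \<in> iso G H"
    using assms(3) by (auto simp: is_iso_def)
  define q where "q = inv_into (carrier G) p"
  have q: "q \<in> iso H G"
    unfolding q_def using assms(1) p by (rule group.iso_set_sym)
  have bij: "bij_betw p (carrier G) (carrier H)"
    using p by (simp add: iso_def)
  have "bij_betw (image_mset p) (product_one_seqs G) (product_one_seqs H)"
  proof (rule bij_betw_byWitness[where f' = "image_mset q"])
    show "\<forall>S\<in>product_one_seqs G. image_mset q (image_mset p S) = S"
    proof
      fix S assume "S \<in> product_one_seqs G"
      then have "image_mset (q \<circ> p) S = image_mset (\<lambda>x. x) S"
        using bij by (intro image_mset_cong)
          (auto simp: q_def dest!: product_one_seqs_terms intro: bij_betw_inv_into_left)
      then show "image_mset q (image_mset p S) = S"
        by (simp add: image_mset.compositionality)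
    qed
    show "\<forall>S\<in>product_one_seqs H. image_mset p (image_mset q S) = S"
    proof
      fix S assume "S \<in> product_one_seqs H"
      then have "image_mset (p \<circ> q) S = image_mset (\<lambda>x. x) S"
        using bij by (intro image_mset_cong)
          (auto simp: q_def dest!: product_one_seqs_terms intro: bij_betw_inv_into_right)
      then show "image_mset p (image_mset q S) = S"
        by (simp add: image_mset.compositionality)
    qed
    show "image_mset p ` product_one_seqs G \<subseteq> product_one_seqs H"
      using map assms(1,2) p by (auto simp: iso_def)
    show "image_mset q ` product_one_seqs H \<subseteq> product_one_seqs G"
      using map assms(1,2) q by (auto simp: iso_def)
  qed
  then have "image_mset p \<in> iso (product_one_monoid G) (product_one_monoid H)"
    by (auto simp: iso_def hom_def dest: bij_betwE)
  then show ?thesis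
    by (rule is_isoI)
qed

lemma product_one_monoid_iso_imp_iso:
  fixes G (structure) and H (structure)
  assumes "group G" and "group H" and tor: "torsion_group G"
    and iso: "product_one_monoid G \<cong> product_one_monoid H"
  shows "G \<cong> H"
proof -
  interpret G: group G by fact
  interpret H: group H by fact
  obtain \<Phi> where "\<Phi> \<in> iso (product_one_monoid G) (product_one_monoid H)"
    using iso by (auto simp: is_iso_def)
  then interpret product_one_iso G H \<Phi>
    by unfold_locales (auto simp: iso_def hom_def)
  obtain f where f: "bij_betw f (carrier G) (carrier H)"
    and f_seq: "\<And>g. g \<in> carrier G \<Longrightarrow> \<Phi> (order_seq G g) = order_seq H (f g)"
    using ex_order_seq_bij[OF tor] by blast
  show ?thesis
  proof (cases "\<exists>a b. carrier G \<subseteq> {a, b}")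
    case True
    then show ?thesis
      using small_groups_iso[OF assms(1,2) _ f] by blast
  next
    case False
    then have big: "\<And>a b. \<not> carrier G \<subseteq> {a, b}"
      by blast
    have "image_mset f S \<in> product_one_seqs H" if "S \<in> product_one_seqs G" for S
      using closed[OF that] eq_image_mset[OF tor f f_seq big that] by simp
    then interpret injective_half_homomorphism G H f
      by (rule half_homomorphismI[OF assms(1,2) f])
    show ?thesis
      by (rule bij_imp_iso[OF f])
  qed
qed

theorem theorem1p1:
  fixes G\<^sub>1 :: "('a, 'c) monoid_scheme" and G\<^sub>2 :: "('b, 'd) monoid_scheme"
  assumes "group G\<^sub>1" and "group G\<^sub>2"
    and "torsion_group G\<^sub>1"
  shows "G\<^sub>1 \<cong> G\<^sub>2 \<longleftrightarrow> product_one_monoid G\<^sub>1 \<cong> product_one_monoid G\<^sub>2"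
  using iso_imp_product_one_monoid_iso[OF assms(1,2)]
    product_one_monoid_iso_imp_iso[OF assms] by blast

end
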